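(* Let $\rho(a,b)\subset\mathbb{R}^3$ be a unit rhombus with diagonals $a,b>0$. Suppose $\rho(a,b)$ can be domed. Then there is a nonzero polynomial $P\in\mathbb{Q}[x,y]$ such that $P(a^2,b^2)=0$.
   Context: A unit rhombus is a closed polygon $[v_1v_2v_3v_4]$ in $\mathbb{R}^3$ with $|v_1v_2|=|v_2v_3|=|v_3v_4|=|v_4v_1|=1$; its diagonals are $a=|v_1v_3|$ and $b=|v_2v_4|$, and $\rho(a,b)$ denotes the unit rhombus with these diagonals (determined up to rigid motion; necessarily $a^2+b^2\le 4$). A closed polygon with unit edges $\gamma=[v_1\dots v_n]$ can be domed if there is a dome over it: a finite connected 2-dimensional simplicial complex $\Sigma$ which is a compact surface (orientable or not, any genus) whose boundary is a single cycle, together with a map $f:\Sigma\to\mathbb{R}^3$ that is linear on each simplex, sends every triangle to an equilateral triangle of side length $1$, and sends the boundary cycle of $\Sigma$ onto $\gamma$, vertex by vertex in cyclic order. No embedding or immersion condition is imposed. *)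

theory Defs
  imports "HOL-Analysis.Analysis" "HOL-Computational_Algebra.Polynomial"
begin

text \<open>A pure 2-dimensional simplicial complex is given by its set of triangles
  (3-element vertex sets); its vertices and edges are the faces of the triangles.\<close>

definition cplx_edges :: "'v set set \<Rightarrow> 'v set set" where
  "cplx_edges T = {e. card e = 2 \<and> (\<exists>t\<in>T. e \<subseteq> t)}"

definition edge_deg :: "'v set set \<Rightarrow> 'v set \<Rightarrow> nat" where
  "edge_deg T e = card {t\<in>T. e \<subseteq> t}"

definition link_edges :: "'v set set \<Rightarrow> 'v \<Rightarrow> 'v set set" where
  "link_edges T v = {t - {v} | t. t \<in> T \<and> v \<in> t}"

definition link_verts :: "'v set set \<Rightarrow> 'v \<Rightarrow> 'v set" where
  "link_verts T v = \<Union>(link_edges T v)"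

definition graph_connected :: "'v set \<Rightarrow> 'v set set \<Rightarrow> bool" where
  "graph_connected V E \<longleftrightarrow> (\<forall>x\<in>V. \<forall>y\<in>V. (\<lambda>u u'. {u, u'} \<in> E)\<^sup>*\<^sup>* x y)"

text \<open>Combinatorial triangulated compact connected surface (possibly with boundary):
  every edge lies in one or two triangles and the link of every vertex is connected
  (hence a path or a cycle).\<close>
definition triangulated_surface :: "'v set set \<Rightarrow> bool" where
  "triangulated_surface T \<longleftrightarrow>
     finite T \<and> T \<noteq> {} \<and> (\<forall>t\<in>T. card t = 3) \<and>
     graph_connected (\<Union>T) (cplx_edges T) \<and>
     (\<forall>e\<in>cplx_edges T. edge_deg T e = 1 \<or> edge_deg T e = 2) \<and>
     (\<forall>v\<in>\<Union>T. graph_connected (link_verts T v) (link_edges T v))"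

definition boundary_edges :: "'v set set \<Rightarrow> 'v set set" where
  "boundary_edges T = {e \<in> cplx_edges T. edge_deg T e = 1}"

definition boundary_cycle :: "'v set set \<Rightarrow> nat \<Rightarrow> (nat \<Rightarrow> 'v) \<Rightarrow> bool" where
  "boundary_cycle T n w \<longleftrightarrow> 3 \<le> n \<and> inj_on w {..<n} \<and>
     boundary_edges T = {{w i, w ((i + 1) mod n)} | i. i < n}"

text \<open>A dome over the closed unit polygon gamma 0, ..., gamma (n-1): a triangulated surface
  T with single boundary cycle and a vertex map f (extended linearly on simplices) sending
  every triangle to a unit equilateral triangle, and the boundary cycle onto gamma.\<close>
definition is_dome :: "'v set set \<Rightarrow> ('v \<Rightarrow> real^3) \<Rightarrow> nat \<Rightarrow> (nat \<Rightarrow> real^3) \<Rightarrow> bool" where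
  "is_dome T f n \<gamma> \<longleftrightarrow> triangulated_surface T \<and>
     (\<forall>t\<in>T. \<forall>x\<in>t. \<forall>y\<in>t. x \<noteq> y \<longrightarrow> dist (f x) (f y) = 1) \<and>
     (\<exists>w. boundary_cycle T n w \<and> (\<forall>i<n. f (w i) = \<gamma> i))"

definition can_be_domed :: "nat \<Rightarrow> (nat \<Rightarrow> real^3) \<Rightarrow> bool" where
  "can_be_domed n \<gamma> \<longleftrightarrow> (\<exists>(T :: nat set set) f. is_dome T f n \<gamma>)"

definition unit_rhombus :: "(nat \<Rightarrow> real^3) \<Rightarrow> real \<Rightarrow> real \<Rightarrow> bool" where
  "unit_rhombus v a b \<longleftrightarrow>
     dist (v 0) (v 1) = 1 \<and> dist (v 1) (v 2) = 1 \<and> dist (v 2) (v 3) = 1 \<and>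
     dist (v 3) (v 0) = 1 \<and> dist (v 0) (v 2) = a \<and> dist (v 1) (v 3) = b"

text \<open>Q[x,y] represented as (Q[x])[y]; eval2 P x y evaluates at (x,y).\<close>
definition eval2 :: "rat poly poly \<Rightarrow> real \<Rightarrow> real \<Rightarrow> real" where
  "eval2 P x y = poly (map_poly (\<lambda>q. poly (map_poly real_of_rat q) x) P) y"

end

theory Submission
  imports Defs
begin

text \<open>
  Suppose \<open>a\<^sup>2\<close> and \<open>b\<^sup>2\<close> were algebraically independent over \<open>\<rat>\<close>. Then \<open>1/a\<^sup>2\<close> and \<open>1/b\<^sup>2\<close> generate a
  proper ideal of \<open>\<rat>[1/a\<^sup>2, 1/b\<^sup>2]\<close>, so some valuation ring \<open>R\<close> of \<open>\<real>\<close> contains \<open>\<rat>\<close> but neither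
  \<open>a\<^sup>2\<close> nor \<open>b\<^sup>2\<close>. Call two vertices of the dome near if their squared distance lies in \<open>R\<close>; all edges
  of the dome are near pairs. If \<open>x\<^sub>0, x\<^sub>1, \<dots>\<close> is a walk through near pairs whose points are all near a
  point \<open>u\<close>, while no \<open>x\<^sub>i, x\<^sub>i\<^sub>+\<^sub>2\<close> are near, then vanishing of 4-by-4 Gram determinants in \<open>\<real>\<^sup>3\<close> forces
  the inner products \<open>(x\<^sub>0 - u) \<bullet> (x\<^sub>k - u)\<close> to grow in the valuation, so the walk never returns. Hence
  every mod 2 cycle in the link of \<open>u\<close> can be shortened step by step and bounds a mod 2 chain of near
  triangles inside the link. Regarding the dome as a mod 2 chain bounded by the rhombus, its interior
  vertices are therefore eliminated one at a time, until a near triangle on the four vertices of the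
  rhombus remains; it contains a diagonal, so \<open>a\<^sup>2 \<in> R\<close> or \<open>b\<^sup>2 \<in> R\<close>.
\<close>

section \<open>Existence of valuation rings\<close>

definition subring_of_field :: "'a::field set \<Rightarrow> bool" where
  "subring_of_field R \<longleftrightarrow> 1 \<in> R \<and> (\<forall>x\<in>R. \<forall>y\<in>R. x - y \<in> R \<and> x * y \<in> R)"

text \<open>For \<open>\<alpha>\<close> and \<open>\<beta>\<close> in \<open>R\<close> this is the
  ideal they generate. Keeping this single ideal proper makes both generators nonunits of
  \<open>R\<close> at once.\<close>

definition ideal2 :: "'a::field \<Rightarrow> 'a \<Rightarrow> 'a set \<Rightarrow> 'a set" where
  "ideal2 \<alpha> \<beta> R = {\<alpha> * r + \<beta> * s | r s. r \<in> R \<and> s \<in> R}"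

lemma subring_of_fieldD:
  assumes "subring_of_field R"
  shows "1 \<in> R" "0 \<in> R" "x \<in> R \<Longrightarrow> y \<in> R \<Longrightarrow> x - y \<in> R" "x \<in> R \<Longrightarrow> y \<in> R \<Longrightarrow> x * y \<in> R"
    "x \<in> R \<Longrightarrow> - x \<in> R" "x \<in> R \<Longrightarrow> y \<in> R \<Longrightarrow> x + y \<in> R"
proof -
  have d: "x - y \<in> R" if "x \<in> R" "y \<in> R" for x y
    using assms that by (auto simp: subring_of_field_def)
  show 1: "1 \<in> R" using assms by (auto simp: subring_of_field_def)
  show 0: "0 \<in> R" using d[OF 1 1] by simp
  have m: "- x \<in> R" if "x \<in> R" for x using d[OF 0 that] by simp
  show "x \<in> R \<Longrightarrow> y \<in> R \<Longrightarrow> x - y \<in> R" by (rule d)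
  show "x \<in> R \<Longrightarrow> - x \<in> R" by (rule m)
  show "x \<in> R \<Longrightarrow> y \<in> R \<Longrightarrow> x * y \<in> R" using assms by (auto simp: subring_of_field_def)
  show "x \<in> R \<Longrightarrow> y \<in> R \<Longrightarrow> x + y \<in> R" using d[of x "- y"] m[of y] by simp
qed

lemma ideal2_closed:
  assumes "subring_of_field R"
  shows "x \<in> ideal2 \<alpha> \<beta> R \<Longrightarrow> y \<in> ideal2 \<alpha> \<beta> R \<Longrightarrow> x + y \<in> ideal2 \<alpha> \<beta> R"
    "x \<in> ideal2 \<alpha> \<beta> R \<Longrightarrow> y \<in> ideal2 \<alpha> \<beta> R \<Longrightarrow> x - y \<in> ideal2 \<alpha> \<beta> R"
    "x \<in> ideal2 \<alpha> \<beta> R \<Longrightarrow> r \<in> R \<Longrightarrow> x * r \<in> ideal2 \<alpha> \<beta> R"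
    "0 \<in> ideal2 \<alpha> \<beta> R"
    "\<alpha> \<in> ideal2 \<alpha> \<beta> R" "\<beta> \<in> ideal2 \<alpha> \<beta> R"
    "\<alpha> \<in> R \<Longrightarrow> \<beta> \<in> R \<Longrightarrow> ideal2 \<alpha> \<beta> R \<subseteq> R"
proof -
  note R = subring_of_fieldD[OF assms]
  have E: "z \<in> ideal2 \<alpha> \<beta> R" if "r \<in> R" "s \<in> R" "z = \<alpha> * r + \<beta> * s" for z r s
    using that by (auto simp: ideal2_def)
  show "x + y \<in> ideal2 \<alpha> \<beta> R" if xy: "x \<in> ideal2 \<alpha> \<beta> R" "y \<in> ideal2 \<alpha> \<beta> R"
  proof -
    from xy obtain r s r' s' where "r \<in> R" "s \<in> R" "r' \<in> R" "s' \<in> R"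
      "x = \<alpha> * r + \<beta> * s" "y = \<alpha> * r' + \<beta> * s'"
      by (auto simp: ideal2_def)
    then show ?thesis by (intro E[of "r + r'" "s + s'"]) (auto simp: R algebra_simps)
  qed
  show "x - y \<in> ideal2 \<alpha> \<beta> R" if xy: "x \<in> ideal2 \<alpha> \<beta> R" "y \<in> ideal2 \<alpha> \<beta> R"
  proof -
    from xy obtain r s r' s' where "r \<in> R" "s \<in> R" "r' \<in> R" "s' \<in> R"
      "x = \<alpha> * r + \<beta> * s" "y = \<alpha> * r' + \<beta> * s'"
      by (auto simp: ideal2_def)
    then show ?thesis by (intro E[of "r - r'" "s - s'"]) (auto simp: R algebra_simps)
  qed
  show "x * r \<in> ideal2 \<alpha> \<beta> R" if x: "x \<in> ideal2 \<alpha> \<beta> R" "r \<in> R"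
  proof -
    from x obtain t s where "t \<in> R" "s \<in> R" "x = \<alpha> * t + \<beta> * s"
      by (auto simp: ideal2_def)
    with x show ?thesis by (intro E[of "t * r" "s * r"]) (auto simp: R algebra_simps)
  qed
  show "0 \<in> ideal2 \<alpha> \<beta> R" by (rule E[of 0 0]) (auto simp: R)
  show "\<alpha> \<in> ideal2 \<alpha> \<beta> R" by (rule E[of 1 0]) (auto simp: R)
  show "\<beta> \<in> ideal2 \<alpha> \<beta> R" by (rule E[of 0 1]) (auto simp: R)
  show "\<alpha> \<in> R \<Longrightarrow> \<beta> \<in> R \<Longrightarrow> ideal2 \<alpha> \<beta> R \<subseteq> R" by (auto simp: ideal2_def R)
qed

text \<open>The ring \<open>R[x]\<close>. As \<open>R\<close> is a set and not a type, its
  polynomials are those over the whole field with all coefficients in \<open>R\<close>.\<close>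

definition adjoin :: "'a::field set \<Rightarrow> 'a \<Rightarrow> 'a set" where
  "adjoin R x = {poly p x | p. \<forall>i. coeff p i \<in> R}"

lemma subring_of_field_sum:
  assumes "subring_of_field R" "\<And>i. i \<in> A \<Longrightarrow> f i \<in> R"
  shows "sum f A \<in> R"
  using assms(2) by (induction A rule: infinite_finite_induct) (auto simp: subring_of_fieldD[OF assms(1)])

lemma subring_adjoin:
  assumes "subring_of_field R"
  shows "subring_of_field (adjoin R x)" "R \<subseteq> adjoin R x" "x \<in> adjoin R x"
proof -
  note R = subring_of_fieldD[OF assms]
  have E: "z \<in> adjoin R x" if "\<And>i. coeff p i \<in> R" "z = poly p x" for z p
    using that by (auto simp: adjoin_def)
  show sub: "R \<subseteq> adjoin R x"
  proof
    fix r assume "r \<in> R"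
    then show "r \<in> adjoin R x"
      by (intro E[of "[:r:]"]) (auto simp: coeff_pCons R split: nat.split)
  qed
  show "x \<in> adjoin R x"
    by (rule E[of "[:0, 1:]"]) (auto simp: coeff_pCons R split: nat.split)
  have "y - z \<in> adjoin R x" "y * z \<in> adjoin R x" if yz: "y \<in> adjoin R x" "z \<in> adjoin R x" for y z
  proof -
    from yz obtain p q where p: "\<forall>i. coeff p i \<in> R" "y = poly p x" and q: "\<forall>i. coeff q i \<in> R" "z = poly q x"
      by (auto simp: adjoin_def)
    show "y - z \<in> adjoin R x" using p q by (intro E[of "p - q"]) (auto simp: R)
    show "y * z \<in> adjoin R x" using p q 
      by (intro E[of "p * q"]) (auto simp: coeff_mult R intro!: subring_of_field_sum[OF assms])
  qed
  then show "subring_of_field (adjoin R x)"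
    using sub R(1) by (auto simp: subring_of_field_def)
qed

text \<open>Chevalley's exchange step: the leading term of the relation for \<open>x\<close> is rewritten with the
  relation for \<open>1/x\<close>.\<close>

lemma lower_degree_relation:
  fixes x :: "'a::field"
  assumes R: "subring_of_field R" and \<alpha>\<beta>: "\<alpha> \<in> R" "\<beta> \<in> R"
    and units: "\<And>j. j \<in> ideal2 \<alpha> \<beta> R \<Longrightarrow> inverse (1 - j) \<in> R"
    and proper: "1 \<notin> ideal2 \<alpha> \<beta> R" and "x \<noteq> 0"
    and h: "\<forall>i. coeff h i \<in> ideal2 \<alpha> \<beta> R" "degree h \<le> n" "poly h x = 1"
    and k: "\<forall>i. coeff k i \<in> ideal2 \<alpha> \<beta> R" "degree k \<le> m" "poly k (inverse x) = 1"
    and "m \<le> n" "0 < n"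
  shows "\<exists>h'. (\<forall>i. coeff h' i \<in> ideal2 \<alpha> \<beta> R) \<and> degree h' \<le> n - 1 \<and> poly h' x = 1"
proof -
  let ?J = "ideal2 \<alpha> \<beta> R"
  note J = ideal2_closed[where \<alpha> = \<alpha> and \<beta> = \<beta>, OF R] and RR = subring_of_fieldD[OF R]
  \<comment> \<open>\<open>g\<close> is \<open>k\<close> without its constant term, reversed with
    respect to \<open>n\<close>; since \<open>m \<le> n\<close>, no term of \<open>k\<close> is
    lost. Multiplying \<open>k(1/x) = 1\<close> by \<open>x ^ n\<close> gives
    \<open>x ^ n * (1 - coeff k 0) = g(x)\<close>, where \<open>g\<close> has degree below
    \<open>n\<close>.\<close>
  define g where "g = (\<Sum>i\<in>{1..n}. monom (coeff k i) (n - i))"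
  define u where "u = inverse (1 - coeff k 0)"
  have u: "u \<in> R" "1 - coeff k 0 \<noteq> 0" using units k(1) proper by (auto simp: u_def dest: spec[of _ 0])
  have Jsum: "sum f A \<in> ?J" if "\<And>i. i \<in> A \<Longrightarrow> f i \<in> ?J" for f and A :: "nat set"
    using that by (induction A rule: infinite_finite_induct) (auto simp: J)
  have gJ: "coeff g i \<in> ?J" for i
    using k(1) by (auto simp: g_def coeff_sum coeff_monom J intro!: Jsum)
  have dg: "degree g \<le> n - 1"
    unfolding g_def by (rule degree_sum_le) (auto intro!: order.trans[OF degree_monom_le])
  have "1 = (\<Sum>i\<le>n. coeff k i * inverse x ^ i)"
    using arg_cong[OF poly_as_sum_of_monoms'[of k n], of "\<lambda>p. poly p (inverse x)"] k(2,3) \<open>m \<le> n\<close>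
    by (simp add: poly_sum poly_monom)
  then have "x ^ n = x ^ n * (\<Sum>i\<le>n. coeff k i * inverse x ^ i)" by simp
  also have "\<dots> = (\<Sum>i\<le>n. coeff k i * x ^ (n - i))"
    unfolding sum_distrib_left using \<open>x \<noteq> 0\<close>
    by (intro sum.cong) (auto simp: power_diff field_simps)
  also have "\<dots> = coeff k 0 * x ^ n + (\<Sum>i\<in>{1..n}. coeff k i * x ^ (n - i))"
    by (simp add: sum.atLeast1_atMost_eq sum.atMost_shift)
  also have "(\<Sum>i\<in>{1..n}. coeff k i * x ^ (n - i)) = poly g x"
    by (simp add: g_def poly_sum poly_monom)
  finally have "x ^ n * (1 - coeff k 0) = poly g x" by (simp add: algebra_simps)
  then have xn: "x ^ n = u * poly g x" using u by (simp add: u_def field_simps)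
  \<comment> \<open>The term of degree \<open>n\<close> in \<open>h\<close> is traded for a multiple
    of \<open>g\<close> by means of \<open>x ^ n = u * g(x)\<close>, which leaves the value at
    \<open>x\<close> unchanged.\<close>
  define h' where "h' = h - monom (coeff h n) n + smult (coeff h n * u) g"
  have "coeff h n \<in> R" using h(1) J(7)[OF \<alpha>\<beta>] by auto
  have "\<forall>i. coeff h' i \<in> ?J"
  proof
    fix i
    have "coeff g i * (coeff h n * u) \<in> ?J" using gJ \<open>coeff h n \<in> R\<close> u by (auto intro!: J RR)
    then show "coeff h' i \<in> ?J"
      using h(1) by (auto simp: h'_def mult.commute[of "coeff g i"] intro!: J)
  qed
  moreover have "degree h' \<le> n - 1"
  proof (rule degree_le, intro allI impI)
    fix i assume "n - 1 < i"
    then have "coeff g i = 0" using dg by (intro coeff_eq_0) auto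
    moreover have "coeff h i = 0" if "i \<noteq> n" using that \<open>n - 1 < i\<close> h(2) by (intro coeff_eq_0) auto
    ultimately show "coeff h' i = 0" by (auto simp: h'_def coeff_monom)
  qed
  moreover have "poly h' x = 1"
    using h(3) xn by (simp add: h'_def poly_monom)
  ultimately show ?thesis by blast
qed

text \<open>Chevalley's argument: Zorn's lemma gives a subring maximal among those that contain
  \<open>R0\<close> and in which \<open>\<alpha>\<close> and \<open>\<beta>\<close> generate a
  proper ideal. Maximality forces \<open>x\<close> or \<open>inverse x\<close> into it; properness
  keeps the inverses of \<open>\<alpha>\<close> and \<open>\<beta>\<close> out.\<close>

lemma exists_valuation_subring:
  fixes \<alpha> \<beta> :: "'a::field"
  assumes R0: "subring_of_field R0" "\<alpha> \<in> R0" "\<beta> \<in> R0" "1 \<notin> ideal2 \<alpha> \<beta> R0"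
    and nonzero: "\<alpha> \<noteq> 0" "\<beta> \<noteq> 0"
  obtains R where "subring_of_field R" "R0 \<subseteq> R" "\<And>x. x \<in> R \<or> inverse x \<in> R"
    "inverse \<alpha> \<notin> R" "inverse \<beta> \<notin> R"
proof -
  define \<A> where "\<A> = {R. subring_of_field R \<and> R0 \<subseteq> R \<and> 1 \<notin> ideal2 \<alpha> \<beta> R}"
  have "\<exists>M\<in>\<A>. \<forall>X\<in>\<A>. M \<subseteq> X \<longrightarrow> X = M"
  proof (rule subset_Zorn_nonempty)
    show "\<A> \<noteq> {}" using R0 by (auto simp: \<A>_def)
    fix C assume C: "C \<noteq> {}" "subset.chain \<A> C"
    then have CA: "\<And>R. R \<in> C \<Longrightarrow> R \<in> \<A>" by (auto simp: subset.chain_def)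
    \<comment> \<open>A relation \<open>1 = \<alpha> * r + \<beta> * s\<close> over the union of a
      chain involves only two ring elements, so it already holds over one member.\<close>
    have two: "\<exists>R\<in>C. x \<in> R \<and> y \<in> R" if xy: "x \<in> \<Union>C" "y \<in> \<Union>C" for x y
    proof -
      obtain X Y where "X \<in> C" "x \<in> X" "Y \<in> C" "y \<in> Y" using xy by blast
      moreover have "X \<subseteq> Y \<or> Y \<subseteq> X"
        using C(2) \<open>X \<in> C\<close> \<open>Y \<in> C\<close> unfolding subset_chain_def by blast
      ultimately show ?thesis by blast
    qed
    have "subring_of_field (\<Union>C)"
      unfolding subring_of_field_def
    proof (intro conjI ballI)
      show "1 \<in> \<Union>C" using C(1) CA by (auto simp: \<A>_def subring_of_field_def)
      fix x y assume "x \<in> \<Union>C" "y \<in> \<Union>C"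
      then obtain R where "R \<in> C" "x \<in> R" "y \<in> R" using two by blast
      then show "x - y \<in> \<Union>C" "x * y \<in> \<Union>C"
        using CA[of R] by (auto simp: \<A>_def subring_of_field_def)
    qed
    moreover have "R0 \<subseteq> \<Union>C" using C(1) CA by (auto simp: \<A>_def)
    moreover have "1 \<notin> ideal2 \<alpha> \<beta> (\<Union>C)"
    proof
      assume "1 \<in> ideal2 \<alpha> \<beta> (\<Union>C)"
      then obtain r s where rs: "r \<in> \<Union>C" "s \<in> \<Union>C" "1 = \<alpha> * r + \<beta> * s"
        unfolding ideal2_def by blast
      then obtain R where "R \<in> C" "r \<in> R" "s \<in> R" using two by blast
      with rs(3) have "1 \<in> ideal2 \<alpha> \<beta> R" unfolding ideal2_def by blast
      then show False using CA[OF \<open>R \<in> C\<close>] by (auto simp: \<A>_def)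
    qed
    ultimately show "\<Union>C \<in> \<A>" by (auto simp: \<A>_def)
  qed
  then obtain R where RA: "R \<in> \<A>" and max: "\<And>X. X \<in> \<A> \<Longrightarrow> R \<subseteq> X \<Longrightarrow> X = R" by blast
  let ?J = "ideal2 \<alpha> \<beta> R"
  have R: "subring_of_field R" and "R0 \<subseteq> R" and proper: "1 \<notin> ?J" using RA by (auto simp: \<A>_def)
  then have \<alpha>\<beta>: "\<alpha> \<in> R" "\<beta> \<in> R" using R0 by auto
  note RR = subring_of_fieldD[OF R] and J = ideal2_closed[where \<alpha> = \<alpha> and \<beta> = \<beta>, OF R]
  have JR: "?J \<subseteq> R" by (rule J(7)) fact+

  have units: "inverse (1 - j) \<in> R" if "j \<in> ?J" for j
  proof -
    \<comment> \<open>\<open>S\<close> is the localization of \<open>R\<close> at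
      \<open>1 + ?J\<close>. The ideal stays proper in it, so \<open>S = R\<close> by maximality,
      and every \<open>1 - j\<close> becomes a unit of \<open>R\<close>.\<close>
    define S where "S = {r / (1 - j) | r j. r \<in> R \<and> j \<in> ?J}"
    have SI: "z \<in> S" if "r \<in> R" "j \<in> ?J" "z = r / (1 - j)" for z r j
      using that by (auto simp: S_def)
    have nz: "1 - j \<noteq> 0" if "j \<in> ?J" for j using that proper by auto
    have RS: "R \<subseteq> S" using SI[of _ 0] J(4) by auto
    have common: "\<exists>r s j. r \<in> R \<and> s \<in> R \<and> j \<in> ?J \<and> x = r / (1 - j) \<and> y = s / (1 - j)"
      if "x \<in> S" "y \<in> S" for x y
    proof -
      obtain r j s i where *: "r \<in> R" "j \<in> ?J" "x = r / (1 - j)" "s \<in> R" "i \<in> ?J" "y = s / (1 - i)"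
        using \<open>x \<in> S\<close> \<open>y \<in> S\<close> by (auto simp: S_def)
      have "1 - (j + i - j * i) = (1 - j) * (1 - i)" by (simp add: algebra_simps)
      moreover have "j + i - j * i \<in> ?J" using * JR by (intro J) auto
      moreover have "r * (1 - i) \<in> R" "s * (1 - j) \<in> R" using * JR by (auto intro!: RR)
      ultimately show ?thesis using * nz[of j] nz[of i]
        by (intro exI[of _ "r * (1 - i)"] exI[of _ "s * (1 - j)"] exI[of _ "j + i - j * i"]) auto
    qed
    have "subring_of_field S" unfolding subring_of_field_def
    proof (intro conjI ballI)
      show "1 \<in> S" using RS RR by auto
      fix x y assume "x \<in> S" "y \<in> S"
      then obtain r s j where *: "r \<in> R" "s \<in> R" "j \<in> ?J" "x = r / (1 - j)" "y = s / (1 - j)"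
        using common by blast
      then show "x - y \<in> S" by (intro SI[of "r - s" j]) (auto simp: RR diff_divide_distrib)
      have "1 - (j + j - j * j) = (1 - j) * (1 - j)" by (simp add: algebra_simps)
      moreover have "j + j - j * j \<in> ?J" using * JR by (intro J) auto
      ultimately show "x * y \<in> S" using * by (intro SI[of "r * s" "j + j - j * j"]) (auto simp: RR)
    qed
    moreover have "1 \<notin> ideal2 \<alpha> \<beta> S"
    proof
      assume "1 \<in> ideal2 \<alpha> \<beta> S"
      then obtain x y where xy: "x \<in> S" "y \<in> S" "1 = \<alpha> * x + \<beta> * y"
        unfolding ideal2_def by blast
      then obtain r s j where *: "r \<in> R" "s \<in> R" "j \<in> ?J" "x = r / (1 - j)" "y = s / (1 - j)"
        using common by blast
      have "1 = (\<alpha> * r + \<beta> * s) / (1 - j)" using xy(3) * by (simp add: add_divide_distrib)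
      then have "1 - j = \<alpha> * r + \<beta> * s" using nz[of j] * by (simp add: eq_divide_eq)
      then have "1 - j \<in> ?J" using * by (auto simp: ideal2_def)
      then have "1 - j + j \<in> ?J" using J(1) * by blast
      then show False using proper by simp
    qed
    ultimately have "S = R" using max[of S] RS \<open>R0 \<subseteq> R\<close> by (auto simp: \<A>_def)
    moreover have "inverse (1 - j) \<in> S" using that by (intro SI[of 1 j]) (auto simp: RR field_simps)
    ultimately show ?thesis by simp
  qed

  \<comment> \<open>For \<open>x\<close> outside \<open>R\<close>, maximality rules out
    \<open>R[x]\<close>, so \<open>\<alpha>\<close> and \<open>\<beta>\<close> generate the unit
    ideal there; this is a polynomial relation for \<open>x\<close> with coefficients in
    \<open>?J\<close>.\<close>
  have relation: "\<exists>h. (\<forall>i. coeff h i \<in> ?J) \<and> poly h x = 1" if "x \<notin> R" for x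
  proof -
    have "adjoin R x \<notin> \<A>" using max[of "adjoin R x"] subring_adjoin[OF R, of x] that by auto
    then have "1 \<in> ideal2 \<alpha> \<beta> (adjoin R x)"
      using subring_adjoin[OF R, of x] \<open>R0 \<subseteq> R\<close> by (auto simp: \<A>_def)
    then obtain p q where pq: "\<forall>i. coeff p i \<in> R" "\<forall>i. coeff q i \<in> R" "1 = \<alpha> * poly p x + \<beta> * poly q x"
      by (auto simp: ideal2_def adjoin_def)
    then show ?thesis
      by (intro exI[of _ "smult \<alpha> p + smult \<beta> q"]) (auto simp: ideal2_def)
  qed

  \<comment> \<open>Of two relations, one for \<open>x\<close> and one for \<open>inverse x\<close>,
    the one with the larger degree bound is lowered by means of the other. The descent ends because
    a relation of degree 0 would put 1 into \<open>?J\<close>.\<close>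
  have no_relations: False
    if "x \<noteq> 0" "\<forall>i. coeff h i \<in> ?J" "degree h \<le> n" "poly h x = 1"
      "\<forall>i. coeff k i \<in> ?J" "degree k \<le> m" "poly k (inverse x) = 1" for x h k n m
    using that
  proof (induction "n + m" arbitrary: n m x h k rule: less_induct)
    case less
    have deg0: False if h: "\<forall>i. coeff h i \<in> ?J" "degree h \<le> 0" "poly h x = 1" for h and x :: 'a
    proof -
      obtain c where "h = [:c:]" using h(2) by (metis degree_eq_zeroE le_zero_eq)
      then show False using h proper by (metis coeff_pCons_0 poly_pCons poly_0 mult_zero_right add_0_right)
    qed
    have "0 < n" "0 < m" using deg0 less.prems by (metis gr0I)+
    show ?case
    proof (cases "m \<le> n")
      case True
      obtain h' where "\<forall>i. coeff h' i \<in> ?J" "degree h' \<le> n - 1" "poly h' x = 1"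
        using lower_degree_relation[OF R \<alpha>\<beta> units proper, of x h n k m] less.prems True \<open>0 < n\<close> by blast
      then show False using less.hyps[of "n - 1" m x h' k] less.prems \<open>0 < n\<close> by auto
    next
      case False
      obtain k' where "\<forall>i. coeff k' i \<in> ?J" "degree k' \<le> m - 1" "poly k' (inverse x) = 1"
        using lower_degree_relation[OF R \<alpha>\<beta> units proper, of "inverse x" k m h n] less.prems False \<open>0 < m\<close>
        by auto
      then show False using less.hyps[of n "m - 1" x h k'] less.prems \<open>0 < m\<close> by auto
    qed
  qed

  have total: "x \<in> R \<or> inverse x \<in> R" for x
  proof (rule ccontr)
    assume *: "\<not> (x \<in> R \<or> inverse x \<in> R)"
    then have "x \<noteq> 0" using RR by auto
    obtain h k where "\<forall>i. coeff h i \<in> ?J" "poly h x = 1" "\<forall>i. coeff k i \<in> ?J" "poly k (inverse x) = 1"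
      using relation[of x] relation[of "inverse x"] * by blast
    then show False using no_relations[OF \<open>x \<noteq> 0\<close>] by blast
  qed
  \<comment> \<open>If \<open>inverse j\<close> were in \<open>R\<close>, then
    \<open>1 = j * inverse j\<close> would lie in the ideal.\<close>
  have notin: "inverse j \<notin> R" if "j \<in> ?J" "j \<noteq> 0" for j
    using J(3)[OF that(1), of "inverse j"] proper that by auto
  show thesis using that[OF R \<open>R0 \<subseteq> R\<close> total notin[OF J(5)] notin[OF J(6)]] nonzero by blast
qed

section \<open>Inner products and valuations\<close>

text \<open>No value group is constructed: \<open>x / y \<in> R\<close> serves to compare the sizes
  of \<open>x\<close> and \<open>y\<close>, and \<open>total\<close> says that any two sizes are
  comparable.\<close>

locale valuation_subring =
  fixes R :: "'a::field set"
  assumes subring: "subring_of_field R"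
    and total: "x \<in> R \<or> inverse x \<in> R"
begin

lemmas closed = subring_of_fieldD[OF subring]

text \<open>Membership in the maximal ideal of \<open>R\<close>, that is, being a nonunit of
  \<open>R\<close>. Zero needs its own clause because \<open>inverse 0 = 0\<close> lies in
  \<open>R\<close>.\<close>

definition infinitesimal :: "'a \<Rightarrow> bool" where
  "infinitesimal x \<longleftrightarrow> x \<in> R \<and> (x = 0 \<or> inverse x \<notin> R)"

lemma infinitesimal_mult:
  assumes "infinitesimal x" "y \<in> R" shows "infinitesimal (x * y)"
proof (cases "x * y = 0")
  case False
  have "inverse x = y * inverse (x * y)" using False by (simp add: field_simps)
  moreover have "inverse x \<notin> R" using assms False by (auto simp: infinitesimal_def)
  ultimately have "inverse (x * y) \<notin> R" using assms closed(4) by metis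
  then show ?thesis using assms by (auto simp: infinitesimal_def closed)
qed (use assms in \<open>auto simp: infinitesimal_def closed\<close>)

lemma infinitesimal_mult_left:
  assumes "x \<in> R" "infinitesimal y" shows "infinitesimal (x * y)"
  using infinitesimal_mult[OF assms(2,1)] by (simp add: mult.commute)

text \<open>By totality one of the summands divides the other in \<open>R\<close> and can be
  factored out of the sum.\<close>

lemma infinitesimal_add:
  assumes "infinitesimal x" "infinitesimal y" shows "infinitesimal (x + y)"
proof (cases "x = 0 \<or> y = 0")
  case False
  have "x / y \<in> R \<or> y / x \<in> R" using total[of "x / y"] by simp
  then show ?thesis
  proof
    assume "x / y \<in> R"
    moreover have "x + y = y * (x / y + 1)" using False by (simp add: field_simps)
    ultimately show ?thesis using infinitesimal_mult[OF assms(2)] by (auto simp: closed)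
  next
    assume "y / x \<in> R"
    moreover have "x + y = x * (1 + y / x)" using False by (simp add: field_simps)
    ultimately show ?thesis using infinitesimal_mult[OF assms(1)] by (auto simp: closed)
  qed
qed (use assms in auto)

lemma infinitesimal_minus: "infinitesimal x \<Longrightarrow> infinitesimal (- x)"
  using infinitesimal_mult[of x "- 1"] by (auto simp: closed)

lemma infinitesimal_add_cancel:
  assumes "x + y = 0" "infinitesimal y" shows "infinitesimal x"
  using infinitesimal_minus[OF assms(2)] assms(1) by (metis add_eq_0_iff2)

lemma infinitesimal_in: "infinitesimal x \<Longrightarrow> x \<in> R"
  by (simp add: infinitesimal_def)

lemma one_not_infinitesimal: "\<not> infinitesimal 1"
  by (simp add: infinitesimal_def closed)

lemma infinitesimal_inverse: "x \<notin> R \<Longrightarrow> infinitesimal (inverse x)"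
  using total[of x] by (auto simp: infinitesimal_def)

text \<open>An element of largest size. Dividing a linear dependence by such a coefficient brings
  all coefficients into \<open>R\<close> and makes one of them equal to 1.\<close>

lemma exists_dominating:
  assumes "finite S" "S \<noteq> {}" "0 \<notin> S"
  shows "\<exists>m\<in>S. \<forall>x\<in>S. x / m \<in> R"
  using assms
proof (induction S rule: finite_ne_induct)
  case (singleton x)
  then show ?case by (auto simp: closed)
next
  case (insert y S)
  then obtain m where m: "m \<in> S" "\<forall>x\<in>S. x / m \<in> R" by auto
  have nz: "m \<noteq> 0" "y \<noteq> 0" using insert m by auto
  have "y / m \<in> R \<or> m / y \<in> R" using total[of "y / m"] by simp
  then show ?case
  proof
    assume "y / m \<in> R"
    then show ?thesis using m by auto
  next
    assume "m / y \<in> R"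
    have "x / y \<in> R" if "x \<in> S" for x
      using closed(4)[of "x / m" "m / y"] m that \<open>m / y \<in> R\<close> nz by auto
    then show ?thesis using nz by (auto simp: closed)
  qed
qed

end

text \<open>A linear map from \<open>real^4\<close> to \<open>real^3\<close> has a nontrivial
  kernel. Indexing by \<open>4\<close> instead of using a set keeps the statement valid when some of
  the vectors coincide.\<close>

lemma four_vectors_dependent:
  fixes x :: "4 \<Rightarrow> real^3"
  shows "\<exists>t. t \<noteq> (\<lambda>_. 0) \<and> (\<Sum>i\<in>UNIV. t i *\<^sub>R x i) = 0"
proof -
  let ?f = "\<lambda>t::real^4. \<Sum>i\<in>UNIV. (t $ i) *\<^sub>R x i"
  have lin: "linear ?f"
    by (rule linearI) (auto simp: scaleR_add_left sum.distrib scaleR_sum_right)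
  have "\<not> inj ?f"
  proof
    assume "inj ?f"
    then have "dim (range ?f) = dim (UNIV :: (real^4) set)" by (intro dim_image_eq lin) auto
    then show False using dim_subset_UNIV_cart[of "range ?f"] by simp
  qed
  then obtain t where "t \<noteq> 0" "?f t = 0"
    using linear_injective_0[OF lin] by auto
  then show ?thesis by (intro exI[of _ "\<lambda>i. t $ i"]) (auto simp: vec_eq_iff fun_eq_iff)
qed

section \<open>Growth of inner products along walks in three-space\<close>

locale real_valuation_subring = valuation_subring R for R :: "real set"
begin

text \<open>The Gram matrix of \<open>p/E, q, r, s/A\<close> with \<open>E = p \<bullet> r\<close> and \<open>A = q \<bullet> s\<close> is singular,
  but if the conclusion failed it would be invertible modulo infinitesimals.\<close>

lemma inner_product_growth:
  fixes p q r s :: "real^3"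
  assumes R: "p \<bullet> p \<in> R" "q \<bullet> q \<in> R" "r \<bullet> r \<in> R" "s \<bullet> s \<in> R" "q \<bullet> r \<in> R" "r \<bullet> s \<in> R"
    and E: "p \<bullet> r \<notin> R" and D: "(p \<bullet> q) / (p \<bullet> r) \<in> R" and A: "q \<bullet> s \<notin> R"
  shows "p \<bullet> s \<notin> R \<and> (p \<bullet> r) / (p \<bullet> s) \<in> R"
proof (rule ccontr)
  assume neg: "\<not> ?thesis"
  define e where "e = inverse (p \<bullet> r)"
  define \<alpha> where "\<alpha> = inverse (q \<bullet> s)"
  have e: "infinitesimal e" and \<alpha>: "infinitesimal \<alpha>"
    using E A by (auto simp: e_def \<alpha>_def infinitesimal_inverse)
  have nz: "p \<bullet> r \<noteq> 0" "q \<bullet> s \<noteq> 0" using E A closed(2) by metis+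
  \<comment> \<open>This is the Gram entry of \<open>p/E\<close> and \<open>s/A\<close>. The negated
    conclusion bounds \<open>p \<bullet> s\<close> either by \<open>R\<close> or by the size of
    \<open>p \<bullet> r\<close>, so the factors \<open>e\<close> and \<open>\<alpha>\<close> make
    it infinitesimal in both cases.\<close>
  have C: "infinitesimal (e * (\<alpha> * (p \<bullet> s)))"
  proof (cases "p \<bullet> s \<in> R")
    case True
    then show ?thesis by (intro infinitesimal_mult[OF e] closed(4) infinitesimal_in[OF \<alpha>])
  next
    case False
    then have "(p \<bullet> r) / (p \<bullet> s) \<notin> R" using neg by auto
    then have "(p \<bullet> s) / (p \<bullet> r) \<in> R" using total[of "(p \<bullet> r) / (p \<bullet> s)"] by simp
    then have "infinitesimal (\<alpha> * ((p \<bullet> s) / (p \<bullet> r)))" using \<alpha> infinitesimal_mult by blast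
    then show ?thesis by (simp add: e_def field_simps)
  qed
  define x :: "4 \<Rightarrow> real^3" where
    "x = (\<lambda>i. if i = 1 then e *\<^sub>R p else if i = 2 then q else if i = 3 then r else \<alpha> *\<^sub>R s)"
  have x: "x 1 = e *\<^sub>R p" "x 2 = q" "x 3 = r" "x 4 = \<alpha> *\<^sub>R s" by (auto simp: x_def)
  obtain t0 where t0: "t0 \<noteq> (\<lambda>_. 0)" "(\<Sum>i\<in>UNIV. t0 i *\<^sub>R x i) = 0"
    using four_vectors_dependent by blast
  have "finite (range t0 - {0})" "range t0 - {0} \<noteq> {}" using t0(1) by auto
  then obtain m where m: "m \<in> range t0 - {0}" "\<forall>y\<in>range t0 - {0}. y / m \<in> R"
    using exists_dominating[of "range t0 - {0}"] by auto
  \<comment> \<open>The dependence is normalized by its largest coefficient, so not all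
    \<open>t i\<close> can be infinitesimal.\<close>
  define t where "t i = t0 i / m" for i
  have tR: "t i \<in> R" for i
    using m closed(2) by (cases "t0 i = 0") (auto simp: t_def)
  obtain k where k: "t k = 1" using m by (auto simp: t_def)
  have "(\<Sum>i\<in>UNIV. t i *\<^sub>R x i) = (1 / m) *\<^sub>R (\<Sum>i\<in>UNIV. t0 i *\<^sub>R x i)"
    by (simp add: t_def scaleR_sum_right divide_inverse mult.commute)
  then have "(\<Sum>i\<in>UNIV. t i *\<^sub>R x i) = 0" using t0(2) by simp
  then have sum0: "t 1 *\<^sub>R x 1 + t 2 *\<^sub>R x 2 + t 3 *\<^sub>R x 3 + t 4 *\<^sub>R x 4 = 0"
    by (simp add: sum_4)
  have row: "t 1 * (x 1 \<bullet> y) + t 2 * (x 2 \<bullet> y) + t 3 * (x 3 \<bullet> y) + t 4 * (x 4 \<bullet> y) = 0" for y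
    using arg_cong[OF sum0, of "\<lambda>z. z \<bullet> y"] by (simp add: inner_add_left)
  have small: "infinitesimal (\<alpha> * (r \<bullet> s))" "infinitesimal (\<alpha> * \<alpha> * (s \<bullet> s))" "infinitesimal (e * e * (p \<bullet> p))"
    using e \<alpha> R by (auto intro: infinitesimal_mult infinitesimal_in)
  note scaled = infinitesimal_mult_left[OF tR]
  have ip: "e * (p \<bullet> r) = 1" "\<alpha> * (q \<bullet> s) = 1" "e * (p \<bullet> q) = (p \<bullet> q) / (p \<bullet> r)"
    using nz by (auto simp: e_def \<alpha>_def field_simps)
  \<comment> \<open>The rows are solved in the order \<open>s/A\<close>, \<open>p/E\<close>,
    \<open>r\<close>, \<open>q\<close>. Each isolates one coefficient with factor 1. The entry
    \<open>(p \<bullet> q) / (p \<bullet> r)\<close> is only known to lie in \<open>R\<close>, so it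
    may be used only after the coefficient beside it is known to be infinitesimal.\<close>
  have t2: "infinitesimal (t 2)"
  proof (rule infinitesimal_add_cancel)
    show "t 2 + (t 1 * (e * (\<alpha> * (p \<bullet> s))) + t 3 * (\<alpha> * (r \<bullet> s)) + t 4 * (\<alpha> * \<alpha> * (s \<bullet> s))) = 0"
      using row[of "\<alpha> *\<^sub>R s"] ip by (simp add: x algebra_simps)
    show "infinitesimal (t 1 * (e * (\<alpha> * (p \<bullet> s))) + t 3 * (\<alpha> * (r \<bullet> s)) + t 4 * (\<alpha> * \<alpha> * (s \<bullet> s)))"
      by (intro infinitesimal_add scaled C small)
  qed
  have t3: "infinitesimal (t 3)"
  proof (rule infinitesimal_add_cancel)
    show "t 3 + (t 1 * (e * e * (p \<bullet> p)) + t 2 * ((p \<bullet> q) / (p \<bullet> r)) + t 4 * (e * (\<alpha> * (p \<bullet> s)))) = 0"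
      using row[of "e *\<^sub>R p"] ip by (simp add: x algebra_simps inner_commute)
    show "infinitesimal (t 1 * (e * e * (p \<bullet> p)) + t 2 * ((p \<bullet> q) / (p \<bullet> r)) + t 4 * (e * (\<alpha> * (p \<bullet> s))))"
      by (intro infinitesimal_add infinitesimal_mult[OF t2 D] scaled C small)
  qed
  have t1: "infinitesimal (t 1)"
  proof (rule infinitesimal_add_cancel)
    show "t 1 + (t 2 * (q \<bullet> r) + t 3 * (r \<bullet> r) + t 4 * (\<alpha> * (r \<bullet> s))) = 0"
      using row[of r] ip by (simp add: x algebra_simps inner_commute)
    show "infinitesimal (t 2 * (q \<bullet> r) + t 3 * (r \<bullet> r) + t 4 * (\<alpha> * (r \<bullet> s)))"
      by (intro infinitesimal_add infinitesimal_mult[OF t2] infinitesimal_mult[OF t3] scaled small R)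
  qed
  have t4: "infinitesimal (t 4)"
  proof (rule infinitesimal_add_cancel)
    show "t 4 + (t 1 * ((p \<bullet> q) / (p \<bullet> r)) + t 2 * (q \<bullet> q) + t 3 * (q \<bullet> r)) = 0"
      using row[of q] ip by (simp add: x algebra_simps inner_commute)
    show "infinitesimal (t 1 * ((p \<bullet> q) / (p \<bullet> r)) + t 2 * (q \<bullet> q) + t 3 * (q \<bullet> r))"
      by (intro infinitesimal_add infinitesimal_mult[OF t1] infinitesimal_mult[OF t2] infinitesimal_mult[OF t3] R D)
  qed
  have "infinitesimal (t k)" using t1 t2 t3 t4 exhaust_4[of k] by auto
  then show False using k one_not_infinitesimal by simp
qed

text \<open>The growth step is applied to \<open>x i\<close> and three consecutive later points. The
  ratio is carried along because it is the hypothesis \<open>D\<close> of the next step.\<close>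

lemma inner_product_walk_infinite:
  fixes x :: "nat \<Rightarrow> real^3"
  assumes "\<And>i. x i \<bullet> x i \<in> R" "\<And>i. x i \<bullet> x (Suc i) \<in> R" "\<And>i. x i \<bullet> x (i + 2) \<notin> R"
  shows "x i \<bullet> x (i + 2 + k) \<notin> R \<and> (x i \<bullet> x (i + 1 + k)) / (x i \<bullet> x (i + 2 + k)) \<in> R"
proof (induction k)
  case 0
  have "inverse (x i \<bullet> x (i + 2)) \<in> R" using total assms(3) by blast
  then show ?case using assms(2)[of i] assms(3)[of i] closed(4) by (simp add: divide_inverse)
next
  case (Suc k)
  show ?case
    using inner_product_growth[of "x i" "x (i + 1 + k)" "x (i + 2 + k)" "x (i + 3 + k)"]
      assms(1) assms(2)[of "i + 1 + k"] assms(2)[of "i + 2 + k"] assms(3)[of "i + 1 + k"] Suc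
    by (simp add: eval_nat_numeral)
qed

text \<open>A walk with finitely many values returns to some point. Without a shortcut, the inner
  products with that point, taken relative to \<open>u\<close>, would never come back into
  \<open>R\<close>.\<close>

lemma finite_walk_has_finite_shortcut:
  fixes x :: "nat \<Rightarrow> real^3"
  assumes half: "1 / 2 \<in> R" and fin: "finite (range x)"
    and u: "\<And>i. (dist u (x i))\<^sup>2 \<in> R" and step: "\<And>i. (dist (x i) (x (Suc i)))\<^sup>2 \<in> R"
  shows "\<exists>i. (dist (x i) (x (i + 2)))\<^sup>2 \<in> R"
proof (rule ccontr)
  assume no: "\<not> ?thesis"
  define y where "y i = x i - u" for i
  have yy: "y i \<bullet> y i \<in> R" for i
    using u[of i] unfolding dist_commute[of u] by (simp add: y_def dist_norm power2_norm_eq_inner)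
  \<comment> \<open>Polarization: squared distances and inner products determine each other up to
    terms in \<open>R\<close>. This is where \<open>half\<close> enters.\<close>
  have iff: "y i \<bullet> y j \<in> R \<longleftrightarrow> (dist (x i) (x j))\<^sup>2 \<in> R" for i j
  proof -
    have *: "(dist (x i) (x j))\<^sup>2 = y i \<bullet> y i + y j \<bullet> y j - 2 * (y i \<bullet> y j)"
      by (simp add: y_def dist_norm power2_norm_eq_inner inner_diff inner_commute)
    have "y i \<bullet> y j = 1 / 2 * (y i \<bullet> y i + y j \<bullet> y j - (dist (x i) (x j))\<^sup>2)"
      unfolding * by simp
    then have "(dist (x i) (x j))\<^sup>2 \<in> R \<Longrightarrow> y i \<bullet> y j \<in> R"
      using half yy closed by metis
    moreover have "y i \<bullet> y j \<in> R \<Longrightarrow> (dist (x i) (x j))\<^sup>2 \<in> R"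
      unfolding * using yy closed by (metis mult_2)
    ultimately show ?thesis by blast
  qed
  have far: "y i \<bullet> y (i + 2 + k) \<notin> R" for i k
    using inner_product_walk_infinite[of y i k] yy iff step no by auto
  have "\<not> inj x" using fin finite_imageD by blast
  then obtain i j where ij: "i < j" "x i = x j"
    unfolding inj_def by (metis linorder_neqE_nat)
  then have eq: "y i = y j" by (simp add: y_def)
  \<comment> \<open>\<open>far\<close> speaks only of indices at least two apart. If the repetition
    is immediate, then \<open>y i \<bullet> y (i + 2)\<close> equals the product of two consecutive
    points instead.\<close>
  show False
  proof (cases "j = Suc i")
    case True
    then have "y i \<bullet> y (i + 2) = y (Suc i) \<bullet> y (Suc (Suc i))" using eq by simp
    then show False using far[of i 0] iff[of "Suc i" "Suc (Suc i)"] step[of "Suc i"] by simp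
  next
    case False
    then have "i + 2 + (j - i - 2) = j" using ij by simp
    then show False using far[of i "j - i - 2"] eq yy[of j] by metis
  qed
qed

end

section \<open>Chains modulo 2\<close>

text \<open>Addition of mod 2 chains, a chain being the set of its simplices.\<close>

definition symdiff :: "'a set \<Rightarrow> 'a set \<Rightarrow> 'a set" where
  "symdiff A B = (A - B) \<union> (B - A)"

lemma finite_symdiff: "finite A \<Longrightarrow> finite B \<Longrightarrow> finite (symdiff A B)"
  by (simp add: symdiff_def)

lemma odd_card_symdiff:
  assumes "finite A" "finite B"
  shows "odd (card (symdiff A B)) \<longleftrightarrow> odd (card A) \<noteq> odd (card B)"
proof -
  have "card (symdiff A B) = card (A - B) + card (B - A)"
    unfolding symdiff_def using assms by (intro card_Un_disjoint) auto
  moreover have "card A = card (A - B) + card (A \<inter> B)" "card B = card (B - A) + card (A \<inter> B)"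
    using assms by (auto simp: Int_commute card_Diff_subset_Int card_mono le_add_diff_inverse2)
  ultimately show ?thesis by auto
qed

text \<open>Linearity of the mod 2 boundary, whose coefficient at \<open>e\<close> is the parity of
  \<open>edge_deg\<close>. For a set of edges and a singleton \<open>e\<close> it is the parity of a
  vertex degree.\<close>

lemma odd_edge_deg_symdiff:
  assumes "finite S" "finite S'"
  shows "odd (edge_deg (symdiff S S') e) \<longleftrightarrow> odd (edge_deg S e) \<noteq> odd (edge_deg S' e)"
proof -
  have "{t \<in> symdiff S S'. e \<subseteq> t} = symdiff {t \<in> S. e \<subseteq> t} {t \<in> S'. e \<subseteq> t}"
    by (auto simp: symdiff_def)
  then show ?thesis unfolding edge_deg_def using assms by (simp add: odd_card_symdiff)
qed

text \<open>The boundary of a triangle is a cycle: a corner lies on two of its edges, any other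
  point on none.\<close>

lemma edge_deg_triangle_boundary:
  assumes "card t = 3"
  shows "even (edge_deg {e. e \<subseteq> t \<and> card e = 2} {x})"
proof -
  obtain a b c where t: "t = {a, b, c}" "a \<noteq> b" "b \<noteq> c" "a \<noteq> c"
    using assms by (auto simp: card_3_iff)
  have "{e. e \<subseteq> t \<and> card e = 2} = {{a, b}, {b, c}, {a, c}}"
    using t by (auto simp: card_2_iff doubleton_eq_iff)
  then have eq: "edge_deg {e. e \<subseteq> t \<and> card e = 2} {x} = card {e \<in> {{a, b}, {b, c}, {a, c}}. x \<in> e}"
    by (simp add: edge_deg_def)
  consider "x = a" | "x = b" | "x = c" | "x \<notin> t" using t by auto
  then show ?thesis
  proof cases
    case 1
    then have "{e \<in> {{a, b}, {b, c}, {a, c}}. x \<in> e} = {{a, b}, {a, c}}" using t by auto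
    then show ?thesis using eq t by (simp add: doubleton_eq_iff)
  next
    case 2
    then have "{e \<in> {{a, b}, {b, c}, {a, c}}. x \<in> e} = {{a, b}, {b, c}}" using t by auto
    then show ?thesis using eq t by (simp add: doubleton_eq_iff)
  next
    case 3
    then have "{e \<in> {{a, b}, {b, c}, {a, c}}. x \<in> e} = {{b, c}, {a, c}}" using t by auto
    then show ?thesis using eq t by (simp add: doubleton_eq_iff)
  next
    case 4
    then have "{e \<in> {{a, b}, {b, c}, {a, c}}. x \<in> e} = {}" using t by auto
    then show ?thesis using eq by (metis card.empty even_zero)
  qed
qed

text \<open>A walk that enters a vertex of even degree can leave it by a different edge, so in a mod
  2 cycle it never has to turn back.\<close>

lemma even_graph_continue:
  assumes "even (edge_deg E {y})" "finite E" "{x, y} \<in> E" "\<forall>e\<in>E. card e = 2"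
  shows "\<exists>z. z \<noteq> x \<and> {y, z} \<in> E"
proof (rule ccontr)
  assume no: "\<not> ?thesis"
  have "{e \<in> E. {y} \<subseteq> e} = {{x, y}}"
  proof (intro equalityI subsetI)
    fix e assume "e \<in> {e \<in> E. {y} \<subseteq> e}"
    then have e: "e \<in> E" "y \<in> e" "card e = 2" using assms by auto
    then obtain z where "e = {y, z}" by (auto simp: card_2_iff)
    with e no show "e \<in> {{x, y}}" by auto
  qed (use assms in auto)
  then show False using assms(1) by (simp add: edge_deg_def)
qed

text \<open>The combinatorial part of the argument sees nearness only as a relation on vertices; all
  the geometry it requires is in \<open>shortcut\<close>.\<close>

locale finiteness_graph =
  fixes fin :: "'v \<Rightarrow> 'v \<Rightarrow> bool"
  assumes refl: "fin x x" and sym: "fin x y \<Longrightarrow> fin y x"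
    and shortcut: "finite (range p) \<Longrightarrow> (\<And>i. fin u (p i)) \<Longrightarrow> (\<And>i. fin (p i) (p (Suc i)))
      \<Longrightarrow> \<exists>i::nat. fin (p i) (p (i + 2))"
begin

definition clique :: "'v set \<Rightarrow> bool" where
  "clique s \<longleftrightarrow> (\<forall>x\<in>s. \<forall>y\<in>s. fin x y)"

lemma clique_subset: "clique s \<Longrightarrow> s' \<subseteq> s \<Longrightarrow> clique s'"
  by (auto simp: clique_def)

text \<open>Induction on the number of edges. A walk without backtracking in the cycle has a
  shortcut, that is, edges \<open>{a, b}\<close> and \<open>{b, c}\<close> with \<open>a\<close> and
  \<open>c\<close> near. Adding the boundary of the triangle \<open>{a, b, c}\<close> gives a cycle
  with fewer edges, whose filling together with this triangle fills the original one.\<close>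

lemma even_link_graph_bounds:
  assumes "finite E" "\<forall>e\<in>E. card e = 2 \<and> clique e \<and> e \<subseteq> N" "\<forall>x\<in>N. fin u x"
    and "\<forall>x. even (edge_deg E {x})"
  shows "\<exists>T. finite T \<and> (\<forall>t\<in>T. card t = 3 \<and> clique t \<and> t \<subseteq> N) \<and>
    (\<forall>e. card e = 2 \<longrightarrow> (odd (edge_deg T e) \<longleftrightarrow> e \<in> E))"
  using assms
proof (induction "card E" arbitrary: E rule: less_induct)
  case less
  show ?case
  proof (cases "E = {}")
    case True
    then show ?thesis by (intro exI[of _ "{}"]) (auto simp: edge_deg_def)
  next
    case False
    then obtain e0 where "e0 \<in> E" by auto
    then obtain p q where pq: "{p, q} \<in> E" using less.prems(2) by (metis card_2_iff)
    \<comment> \<open>The state of the walk is a directed edge, so that the choice of the next one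
      can exclude turning back.\<close>
    have "\<exists>f. \<forall>n::nat. {fst (f n), snd (f n)} \<in> E \<and>
        (fst (f (Suc n)) = snd (f n) \<and> snd (f (Suc n)) \<noteq> fst (f n))"
    proof (rule dependent_nat_choice)
      show "\<exists>x. {fst x, snd x} \<in> E" using pq by auto
      fix x :: "'v \<times> 'v" assume "{fst x, snd x} \<in> E"
      then obtain z where "z \<noteq> fst x" "{snd x, z} \<in> E"
        using even_graph_continue[of E "snd x" "fst x"] less.prems by auto
      then show "\<exists>y. {fst y, snd y} \<in> E \<and> fst y = snd x \<and> snd y \<noteq> fst x"
        by (intro exI[of _ "(snd x, z)"]) auto
    qed
    then obtain f where f: "\<And>n::nat. {fst (f n), snd (f n)} \<in> E"
      "\<And>n. fst (f (Suc n)) = snd (f n)" "\<And>n. snd (f (Suc n)) \<noteq> fst (f n)" by blast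
    define x where "x n = fst (f n)" for n
    have x: "{x n, x (Suc n)} \<in> E" "x (n + 2) \<noteq> x n" for n
      using f(1)[of n] f(2)[of n] f(2)[of "Suc n"] f(3)[of n] by (auto simp: x_def)
    have "range x \<subseteq> \<Union>E" using x(1) by auto
    moreover have "finite (\<Union>E)"
      using less.prems(1,2) by (auto intro!: finite_Union simp: card_2_iff)
    ultimately have "finite (range x)" by (rule finite_subset)
    moreover have "fin u (x n)" for n using x(1)[of n] less.prems(2,3) by blast
    moreover have "fin (x n) (x (Suc n))" for n
      using x(1)[of n] less.prems(2) by (auto simp: clique_def)
    ultimately obtain i where i: "fin (x i) (x (i + 2))" using shortcut by blast
    define a b c where "a = x i" and "b = x (Suc i)" and "c = x (i + 2)"
    have ab: "{a, b} \<in> E" and bc: "{b, c} \<in> E" and ac: "a \<noteq> c"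
      using x(1)[of i] x(1)[of "Suc i"] x(2)[of i] by (auto simp: a_def b_def c_def)
    have ne: "a \<noteq> b" "b \<noteq> c" using ab bc less.prems(2) by fastforce+
    have abN: "fin a b" "fin b c" "fin a c" "a \<in> N" "b \<in> N" "c \<in> N"
      using ab bc less.prems(2) i by (auto simp: clique_def a_def c_def)
    define t where "t = {a, b, c}"
    have t: "card t = 3" "clique t" "t \<subseteq> N"
      using ne ac abN refl sym by (auto simp: t_def clique_def)
    define F where "F = {e. e \<subseteq> t \<and> card e = 2}"
    have F: "F = {{a, b}, {b, c}, {a, c}}"
      using ne ac by (auto simp: F_def t_def card_2_iff doubleton_eq_iff)
    have "finite F" by (simp add: F)
    let ?E' = "symdiff E F"
    \<comment> \<open>Two edges disappear and at most \<open>{a, c}\<close> is new; if it was in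
      \<open>E\<close> already, it cancels as well.\<close>
    have "?E' \<subseteq> insert {a, c} (E - {{a, b}, {b, c}})" using F ab bc by (auto simp: symdiff_def)
    then have "card ?E' \<le> card (insert {a, c} (E - {{a, b}, {b, c}}))"
      using less.prems(1) by (intro card_mono) auto
    also have "\<dots> \<le> Suc (card (E - {{a, b}, {b, c}}))" by (rule card_insert_le_m1) auto
    also have "card (E - {{a, b}, {b, c}}) = card E - 2"
      using ab bc less.prems(1) ne ac by (subst card_Diff_subset) (auto simp: doubleton_eq_iff)
    also have "Suc (card E - 2) < card E"
    proof -
      have "card {{a, b}, {b, c}} \<le> card E" using ab bc less.prems(1) by (intro card_mono) auto
      then show ?thesis using ne ac by (auto simp: doubleton_eq_iff)
    qed
    finally have "card ?E' < card E" .
    moreover have "finite ?E'" using less.prems(1) \<open>finite F\<close> by (rule finite_symdiff)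
    moreover have "\<forall>e\<in>?E'. card e = 2 \<and> clique e \<and> e \<subseteq> N"
      using less.prems(2) t clique_subset[of t] by (auto simp: symdiff_def F_def)
    moreover have "\<forall>x. even (edge_deg ?E' {x})"
    proof
      fix x
      have "even (edge_deg F {x})" unfolding F_def by (rule edge_deg_triangle_boundary) fact
      then show "even (edge_deg ?E' {x})"
        using odd_edge_deg_symdiff[OF less.prems(1) \<open>finite F\<close>, of "{x}"] less.prems(4) by auto
    qed
    ultimately obtain T where T: "finite T" "\<forall>t\<in>T. card t = 3 \<and> clique t \<and> t \<subseteq> N"
      "\<forall>e. card e = 2 \<longrightarrow> (odd (edge_deg T e) \<longleftrightarrow> e \<in> ?E')"
      using less.hyps[of ?E'] less.prems(3) by blast
    show ?thesis
    proof (intro exI[of _ "symdiff T {t}"] conjI allI impI)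
      show "finite (symdiff T {t})" using T(1) by (simp add: finite_symdiff)
      show "\<forall>t\<in>symdiff T {t}. card t = 3 \<and> clique t \<and> t \<subseteq> N" using T(2) t by (auto simp: symdiff_def)
      fix e :: "'v set" assume e: "card e = 2"
      have "{s \<in> {t}. e \<subseteq> s} = (if e \<subseteq> t then {t} else {})" by auto
      then have "odd (edge_deg {t} e) \<longleftrightarrow> e \<in> F" using e by (auto simp: edge_deg_def F_def)
      then show "odd (edge_deg (symdiff T {t}) e) \<longleftrightarrow> e \<in> E"
        using odd_edge_deg_symdiff[OF T(1), of "{t}" e] T(3) e by (auto simp: symdiff_def)
    qed
  qed
qed

text \<open>The star of \<open>u\<close> is replaced by a filling of its link.\<close>

lemma eliminate_vertex:
  assumes T: "finite T" "\<forall>t\<in>T. card t = 3 \<and> clique t"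
    and u: "\<forall>x. x \<noteq> u \<longrightarrow> even (edge_deg T {u, x})"
  shows "\<exists>T'. finite T' \<and> (\<forall>t\<in>T'. card t = 3 \<and> clique t) \<and> \<Union>T' \<subseteq> \<Union>T - {u} \<and>
    (\<forall>e. card e = 2 \<and> u \<notin> e \<longrightarrow> (odd (edge_deg T' e) \<longleftrightarrow> odd (edge_deg T e)))"
proof -
  define S where "S = {t \<in> T. u \<in> t}"
  define L where "L = (\<lambda>t. t - {u}) ` S"
  have inj: "inj_on (\<lambda>t. t - {u}) S" by (auto simp: inj_on_def S_def)
  have finS: "finite S" "finite L" using T by (auto simp: S_def L_def)
  have finite_tri: "finite t" if "t \<in> T" for t using T(2) that by (metis card.infinite zero_neq_numeral)
  define N where "N = \<Union>S - {u}"
  have L: "\<forall>e\<in>L. card e = 2 \<and> clique e \<and> e \<subseteq> N"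
    using T finite_tri by (auto simp: L_def S_def N_def clique_def)
  have N: "\<forall>x\<in>N. fin u x" using T(2) by (auto simp: N_def S_def clique_def)
  \<comment> \<open>Deleting \<open>u\<close> matches the triangles through \<open>{u, x}\<close>
    with the edges of the link at \<open>x\<close>, so the link is a mod 2 cycle.\<close>
  have even_deg: "even (edge_deg L {x})" for x
  proof (cases "x = u")
    case True
    then have "{e \<in> L. {x} \<subseteq> e} = {}" by (auto simp: L_def)
    then show ?thesis by (simp only: edge_deg_def card.empty) simp
  next
    case False
    have "{e \<in> L. {x} \<subseteq> e} = (\<lambda>t. t - {u}) ` {t \<in> T. {u, x} \<subseteq> t}"
      using False by (auto simp: L_def S_def)
    moreover have "inj_on (\<lambda>t. t - {u}) {t \<in> T. {u, x} \<subseteq> t}"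
      by (rule inj_on_subset[OF inj]) (auto simp: S_def)
    ultimately have "edge_deg L {x} = edge_deg T {u, x}"
      by (simp only: edge_deg_def card_image)
    then show ?thesis using u False by simp
  qed
  obtain T1 where T1: "finite T1" "\<forall>t\<in>T1. card t = 3 \<and> clique t \<and> t \<subseteq> N"
    "\<And>e. card e = 2 \<Longrightarrow> odd (edge_deg T1 e) \<longleftrightarrow> e \<in> L"
    using even_link_graph_bounds[OF finS(2) L N] even_deg by blast
  show ?thesis
  \<comment> \<open>The sum is taken mod 2 because the filling may contain triangles that are
    already present outside the star.\<close>
  proof (intro exI[of _ "symdiff (T - S) T1"] conjI allI impI)
    have fTS: "finite (T - S)" using T(1) by simp
    show "finite (symdiff (T - S) T1)" using T T1 by (intro finite_symdiff) auto
    show "\<forall>t\<in>symdiff (T - S) T1. card t = 3 \<and> clique t" using T T1 by (auto simp: symdiff_def)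
    show "\<Union>(symdiff (T - S) T1) \<subseteq> \<Union>T - {u}"
      using T1(2) by (fastforce simp: symdiff_def S_def N_def)
    fix e :: "'v set" assume e: "card e = 2 \<and> u \<notin> e"
    \<comment> \<open>Away from \<open>u\<close>, the boundary of the star is the link: an edge
      avoiding \<open>u\<close> lies in at most one triangle of the star, its cone with apex
      \<open>u\<close>.\<close>
    have "{t \<in> S. e \<subseteq> t} = (if e \<in> L then {insert u e} else {})"
    proof -
      have "t = insert u e" if "t \<in> S" "e \<subseteq> t" for t
      proof -
        have "card (t - {u}) = 2" "e \<subseteq> t - {u}" "finite (t - {u})"
          using that e L finite_tri by (auto simp: L_def S_def)
        then have "e = t - {u}" using e by (intro card_subset_eq) auto
        then show ?thesis using that by (auto simp: S_def)
      qed
      moreover have "e \<in> L \<longleftrightarrow> (\<exists>t\<in>S. e = t - {u})" by (auto simp: L_def)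
      ultimately show ?thesis using e by (auto simp: S_def insert_absorb)
    qed
    then have "odd (edge_deg S e) \<longleftrightarrow> e \<in> L" by (simp add: edge_deg_def)
    moreover have "edge_deg T e = edge_deg S e + edge_deg (T - S) e"
    proof -
      have "{t \<in> T. e \<subseteq> t} = {t \<in> S. e \<subseteq> t} \<union> {t \<in> T - S. e \<subseteq> t}" by (auto simp: S_def)
      then show ?thesis unfolding edge_deg_def using T(1) finS
        by (simp add: card_Un_disjoint disjoint_iff)
    qed
    ultimately show "odd (edge_deg (symdiff (T - S) T1) e) \<longleftrightarrow> odd (edge_deg T e)"
      using odd_edge_deg_symdiff[OF fTS T1(1), of e] T1(3)[of e] e by auto
  qed
qed

text \<open>Induction on the number of vertices outside the four-cycle, each of which can be
  eliminated without changing the boundary. Once none is left, a triangle on the edge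
  \<open>{w0, w1}\<close> has \<open>w2\<close> or \<open>w3\<close> as third vertex and so contains
  a diagonal.\<close>

lemma bounding_four_cycle_has_diagonal:
  assumes "finite T" "\<forall>t\<in>T. card t = 3 \<and> clique t"
    and w: "distinct [w0, w1, w2, w3]"
    and bd: "\<forall>e. card e = 2 \<longrightarrow> (odd (edge_deg T e) \<longleftrightarrow> e \<in> {{w0, w1}, {w1, w2}, {w2, w3}, {w3, w0}})"
  shows "fin w0 w2 \<or> fin w1 w3"
  using assms(1,2) bd
proof (induction "card (\<Union>T - {w0, w1, w2, w3})" arbitrary: T rule: less_induct)
  case less
  let ?W = "{w0, w1, w2, w3}" and ?B = "{{w0, w1}, {w1, w2}, {w2, w3}, {w3, w0}}"
  have finT: "finite (\<Union>T)" 
    using less.prems(1,2) by (intro finite_Union) (metis card.infinite zero_neq_numeral)+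
  show ?case
  proof (cases "\<Union>T \<subseteq> ?W")
    case True
    have "odd (edge_deg T {w0, w1})" using less.prems(3) w by auto
    then obtain t where "t \<in> T" "{w0, w1} \<subseteq> t"
      unfolding edge_deg_def by (metis (no_types, lifting) card.empty empty_Collect_eq even_zero)
    then have t: "card t = 3" "clique t" "t \<subseteq> ?W" "w0 \<in> t" "w1 \<in> t" using less.prems(2) True by auto
    have "\<not> t \<subseteq> {w0, w1}"
    proof
      assume "t \<subseteq> {w0, w1}"
      then have "card t \<le> card {w0, w1}" by (intro card_mono) auto
      then show False using t(1) w by auto
    qed
    then have "w2 \<in> t \<or> w3 \<in> t" using t by auto
    then show ?thesis using t by (auto simp: clique_def)
  next
    case False
    then obtain u where u: "u \<in> \<Union>T" "u \<notin> ?W" by blast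
    have uB: "{u, x} \<notin> ?B" for x using u by (auto simp: doubleton_eq_iff)
    have even_u: "\<forall>x. x \<noteq> u \<longrightarrow> even (edge_deg T {u, x})"
    proof (intro allI impI)
      fix x assume "x \<noteq> u"
      then have "card {u, x} = 2" by auto
      then show "even (edge_deg T {u, x})" using less.prems(3) uB[of x] by blast
    qed
    obtain T' where T': "finite T'" "\<forall>t\<in>T'. card t = 3 \<and> clique t" "\<Union>T' \<subseteq> \<Union>T - {u}"
      "\<forall>e. card e = 2 \<and> u \<notin> e \<longrightarrow> (odd (edge_deg T' e) \<longleftrightarrow> odd (edge_deg T e))"
      using eliminate_vertex[OF less.prems(1,2) even_u] by (elim exE conjE)
    have "card (\<Union>T' - ?W) < card (\<Union>T - ?W)"
    proof (rule psubset_card_mono)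
      have "\<Union>T' - ?W \<subseteq> \<Union>T - ?W" using T'(3) by (intro Diff_mono) (rule subset_trans, assumption, auto)
      moreover have "u \<in> \<Union>T - ?W" "u \<notin> \<Union>T'" using u T'(3) by (simp, blast)
      ultimately show "\<Union>T' - ?W \<subset> \<Union>T - ?W" by (metis DiffD1 psubsetI)
    qed (use finT in simp)
    moreover have "odd (edge_deg T' e) \<longleftrightarrow> e \<in> ?B" if e: "card e = 2" for e
    proof (cases "u \<in> e")
      case True
      then have "{t \<in> T'. e \<subseteq> t} = {}" using T'(3) by auto
      then have "even (edge_deg T' e)" by (simp only: edge_deg_def card.empty) simp
      moreover have "e \<notin> ?B" using True u by auto
      ultimately show ?thesis by blast
    next
      case False
      then show ?thesis using T'(4) less.prems(3) e by simp
    qed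
    ultimately show ?thesis using T'(1,2) by (intro less.hyps[of T']) simp_all
  qed
qed

end

section \<open>The ring generated by two inverses\<close>

lemma map_poly_add_hom:
  assumes "h 0 = 0" "\<And>x y. h (x + y) = h x + h y"
  shows "map_poly h (p + q) = map_poly h p + map_poly h q"
  by (rule poly_eqI) (simp add: coeff_map_poly assms)

lemma map_poly_mult_hom:
  fixes h :: "'a::comm_semiring_1 \<Rightarrow> 'b::comm_semiring_1"
  assumes "h 0 = 0" "\<And>x y. h (x + y) = h x + h y" "\<And>x y. h (x * y) = h x * h y"
  shows "map_poly h (p * q) = map_poly h p * map_poly h q"
  by (induction p) (simp_all add: map_poly_pCons map_poly_smult map_poly_add_hom assms)

lemma eval2_add: "eval2 (P + Q) x y = eval2 P x y + eval2 Q x y"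
  unfolding eval2_def by (simp add: map_poly_add_hom of_rat_add)

lemma eval2_mult: "eval2 (P * Q) x y = eval2 P x y * eval2 Q x y"
  unfolding eval2_def
  by (subst map_poly_mult_hom) (simp_all add: map_poly_add_hom map_poly_mult_hom of_rat_add of_rat_mult)

lemma eval2_diff: "eval2 (P - Q) x y = eval2 P x y - eval2 Q x y"
  using eval2_add[of "P - Q" Q x y] by simp

lemma eval2_monom: "eval2 (monom (monom c k) l) x y = of_rat c * x ^ k * y ^ l"
  by (simp add: eval2_def map_poly_monom poly_monom)

text \<open>In \<open>(Q[x])[y]\<close> the outer variable is \<open>y\<close>: \<open>m\<close>
  bounds the degree in \<open>x\<close> and \<open>n\<close> the degree in \<open>y\<close>.\<close>

definition bidegree_le :: "'a::comm_ring_1 poly poly \<Rightarrow> nat \<Rightarrow> nat \<Rightarrow> bool" where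
  "bidegree_le P m n \<longleftrightarrow> degree P \<le> n \<and> (\<forall>i. degree (coeff P i) \<le> m)"

lemma bidegree_le_mult:
  assumes "bidegree_le P m n" "bidegree_le Q m' n'"
  shows "bidegree_le (P * Q) (m + m') (n + n')"
proof -
  have "degree (coeff (P * Q) i) \<le> m + m'" for i
    unfolding coeff_mult using assms
    by (intro degree_sum_le order.trans[OF degree_mult_le] add_mono) (auto simp: bidegree_le_def)
  moreover have "degree (P * Q) \<le> n + n'"
    using assms by (intro order.trans[OF degree_mult_le] add_mono) (auto simp: bidegree_le_def)
  ultimately show ?thesis by (simp add: bidegree_le_def)
qed

lemma bidegree_le_diff:
  "bidegree_le P m n \<Longrightarrow> bidegree_le Q m n \<Longrightarrow> bidegree_le (P - Q) m n"
  by (simp add: bidegree_le_def degree_diff_le)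

lemma bidegree_le_monom: "bidegree_le (monom (monom c m) n) m n"
  by (auto simp: bidegree_le_def degree_monom_le)

text \<open>This is \<open>\<rat>[1/x, 1/y]\<close>, written so that no polynomials have to be reversed.\<close>

definition inverse_ring :: "real \<Rightarrow> real \<Rightarrow> real set" where
  "inverse_ring x y = {eval2 P x y / (x ^ m * y ^ n) | P m n. bidegree_le P m n}"

lemma inverse_ringI:
  "bidegree_le P m n \<Longrightarrow> z = eval2 P x y / (x ^ m * y ^ n) \<Longrightarrow> z \<in> inverse_ring x y"
  by (auto simp: inverse_ring_def)

lemma inverse_ring_common_denominator:
  assumes "x \<noteq> 0" "y \<noteq> 0" "z \<in> inverse_ring x y" "z' \<in> inverse_ring x y"
  obtains P Q m n where "bidegree_le P m n" "bidegree_le Q m n"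
    "z = eval2 P x y / (x ^ m * y ^ n)" "z' = eval2 Q x y / (x ^ m * y ^ n)"
proof -
  obtain P m n where P: "bidegree_le P m n" "z = eval2 P x y / (x ^ m * y ^ n)"
    using assms(3) by (auto simp: inverse_ring_def)
  obtain Q k l where Q: "bidegree_le Q k l" "z' = eval2 Q x y / (x ^ k * y ^ l)"
    using assms(4) by (auto simp: inverse_ring_def)
  show thesis
  proof (rule that)
    show "bidegree_le (P * monom (monom 1 k) l) (m + k) (n + l)"
      by (intro bidegree_le_mult P bidegree_le_monom)
    have "bidegree_le (Q * monom (monom 1 m) n) (k + m) (l + n)"
      by (intro bidegree_le_mult Q bidegree_le_monom)
    then show "bidegree_le (Q * monom (monom 1 m) n) (m + k) (n + l)" by (simp add: add.commute)
  qed (use assms in \<open>simp_all add: P Q eval2_mult eval2_monom power_add\<close>)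
qed

lemma of_rat_in_inverse_ring: "of_rat c \<in> inverse_ring x y"
  using bidegree_le_monom[of c 0 0]
  by (rule inverse_ringI) (use eval2_monom[of c 0 0 x y] in simp)

lemma subring_inverse_ring:
  assumes "x \<noteq> 0" "y \<noteq> 0"
  shows "subring_of_field (inverse_ring x y)"
  unfolding subring_of_field_def
proof (intro conjI ballI)
  show "1 \<in> inverse_ring x y" using of_rat_in_inverse_ring[of 1] by simp
  fix z z' assume "z \<in> inverse_ring x y" "z' \<in> inverse_ring x y"
  then obtain P Q m n where *: "bidegree_le P m n" "bidegree_le Q m n"
    "z = eval2 P x y / (x ^ m * y ^ n)" "z' = eval2 Q x y / (x ^ m * y ^ n)"
    using inverse_ring_common_denominator[OF assms] by metis
  show "z - z' \<in> inverse_ring x y"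
    by (rule inverse_ringI[OF bidegree_le_diff[OF *(1,2)]]) (simp add: * eval2_diff diff_divide_distrib)
  show "z * z' \<in> inverse_ring x y"
    by (rule inverse_ringI[OF bidegree_le_mult[OF *(1,2)]]) (simp add: * eval2_mult power_add)
qed

lemma inverse_in_inverse_ring:
  "inverse x \<in> inverse_ring x y" "inverse y \<in> inverse_ring x y"
proof -
  have one: "eval2 1 x y = 1" using eval2_monom[of 1 0 0 x y] by (simp add: monom_eq_1)
  show "inverse x \<in> inverse_ring x y"
    by (rule inverse_ringI[of 1 1 0]) (auto simp: bidegree_le_def one field_simps)
  show "inverse y \<in> inverse_ring x y"
    by (rule inverse_ringI[of 1 0 1]) (auto simp: bidegree_le_def one field_simps)
qed

text \<open>Clearing denominators in \<open>1 = z / x + z' / y\<close> gives a polynomial relation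
  between \<open>x\<close> and \<open>y\<close>. It is nontrivial because the bidegree bounds leave
  nothing to cancel its leading monomial.\<close>

lemma inverses_generate_proper_ideal:
  assumes xy: "x \<noteq> 0" "y \<noteq> 0" and indep: "\<And>P. P \<noteq> 0 \<Longrightarrow> eval2 P x y \<noteq> 0"
  shows "1 \<notin> ideal2 (inverse x) (inverse y) (inverse_ring x y)"
proof
  assume "1 \<in> ideal2 (inverse x) (inverse y) (inverse_ring x y)"
  then obtain z z' where z: "z \<in> inverse_ring x y" "z' \<in> inverse_ring x y"
    "1 = inverse x * z + inverse y * z'"
    unfolding ideal2_def by blast
  obtain P Q m n where *: "bidegree_le P m n" "bidegree_le Q m n"
    "z = eval2 P x y / (x ^ m * y ^ n)" "z' = eval2 Q x y / (x ^ m * y ^ n)"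
    by (rule inverse_ring_common_denominator[OF xy z(1,2)])
  \<comment> \<open>This is \<open>x^(m+1) y^(n+1) - y P - x Q\<close>. The product
    \<open>y P\<close> has degree at most \<open>m\<close> in \<open>x\<close>, and
    \<open>x Q\<close> has degree at most \<open>n\<close> in \<open>y\<close>, so the first
    monomial keeps coefficient 1.\<close>
  define G where "G = monom (monom 1 (Suc m)) (Suc n) - monom (monom 1 0) 1 * P - monom (monom 1 1) 0 * Q"
  have "coeff Q (Suc n) = 0" "coeff (coeff P n) (Suc m) = 0"
    using * by (auto simp: bidegree_le_def less_Suc_eq_le intro!: coeff_eq_0)
  then have "coeff (coeff G (Suc n)) (Suc m) = 1"
    by (simp add: G_def coeff_monom_mult)
  then have "G \<noteq> 0" by auto
  moreover have "eval2 G x y = 0"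
  proof -
    have "x ^ Suc m * y ^ Suc n = x ^ Suc m * y ^ Suc n * (inverse x * z + inverse y * z')"
      using z(3) by simp
    also have "\<dots> = y * eval2 P x y + x * eval2 Q x y"
      using xy by (simp add: * field_simps)
    finally show ?thesis
      using eval2_monom[of 1 0 1 x y] by (simp add: G_def eval2_diff eval2_mult eval2_monom)
  qed
  ultimately show False using indep by blast
qed

section \<open>Domes over rhombi\<close>

theorem theorem1p1:
  fixes v :: "nat \<Rightarrow> real^3" and a b :: real
  assumes "a > 0" and "b > 0"
    and "unit_rhombus v a b"
    and "can_be_domed 4 v"
  shows "\<exists>P :: rat poly poly. P \<noteq> 0 \<and> eval2 P (a^2) (b^2) = 0"
proof (rule ccontr)
  assume "\<not> ?thesis"
  then have indep: "\<And>P. P \<noteq> 0 \<Longrightarrow> eval2 P (a\<^sup>2) (b\<^sup>2) \<noteq> 0" by blast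
  have nz: "a\<^sup>2 \<noteq> 0" "b\<^sup>2 \<noteq> 0" using assms by auto
  \<comment> \<open>The two generators are \<open>inverse (a\<^sup>2)\<close> and
    \<open>inverse (b\<^sup>2)\<close>, so the excluded inverses are the squared diagonals
    themselves.\<close>
  obtain R where R: "subring_of_field R" "inverse_ring (a\<^sup>2) (b\<^sup>2) \<subseteq> R"
    "\<And>x. x \<in> R \<or> inverse x \<in> R" "inverse (inverse (a\<^sup>2)) \<notin> R" "inverse (inverse (b\<^sup>2)) \<notin> R"
    using exists_valuation_subring[OF subring_inverse_ring[OF nz] inverse_in_inverse_ring
        inverses_generate_proper_ideal[OF nz indep]] nz by auto
  interpret real_valuation_subring R by unfold_locales (use R in auto)
  have half: "1 / 2 \<in> R"
    using of_rat_in_inverse_ring[of "1 / 2" "a\<^sup>2" "b\<^sup>2"] R(2) by (auto simp: of_rat_divide)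
  obtain T :: "nat set set" and f where dome: "is_dome T f 4 v"
    using assms(4) by (auto simp: can_be_domed_def)
  then obtain w where w: "boundary_cycle T 4 w" "\<forall>i<4. f (w i) = v i"
    and T: "triangulated_surface T" and unit: "\<forall>t\<in>T. \<forall>x\<in>t. \<forall>y\<in>t. x \<noteq> y \<longrightarrow> dist (f x) (f y) = 1"
    by (auto simp: is_dome_def)
  \<comment> \<open>Nearness is a relation on abstract vertices, compared through their images under
    \<open>f\<close>; hence it does not matter whether \<open>f\<close> is injective.\<close>
  interpret finiteness_graph "\<lambda>x y. (dist (f x) (f y))\<^sup>2 \<in> R"
  proof
    show "(dist (f x) (f x))\<^sup>2 \<in> R" for x using closed(2) by simp
    show "(dist (f x) (f y))\<^sup>2 \<in> R \<Longrightarrow> (dist (f y) (f x))\<^sup>2 \<in> R" for x y by (simp add: dist_commute)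
    fix p :: "nat \<Rightarrow> nat" and u
    assume p: "finite (range p)" "\<And>i. (dist (f u) (f (p i)))\<^sup>2 \<in> R"
      "\<And>i. (dist (f (p i)) (f (p (Suc i))))\<^sup>2 \<in> R"
    have "finite (range (f \<circ> p))" using finite_imageI[OF p(1), of f] by (simp add: image_comp)
    then show "\<exists>i. (dist (f (p i)) (f (p (i + 2))))\<^sup>2 \<in> R"
      using finite_walk_has_finite_shortcut[OF half, of "f \<circ> p" "f u"] p by simp
  qed
  have ex4: "(\<exists>i<4. Q i) \<longleftrightarrow> Q 0 \<or> Q 1 \<or> Q 2 \<or> Q (3::nat)" for Q
    by (auto simp: numeral_eq_Suc less_Suc_eq)
  have B: "boundary_edges T = {{w 0, w 1}, {w 1, w 2}, {w 2, w 3}, {w 3, w 0}}"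
  proof -
    have mods: "(0 + 1) mod 4 = (1::nat)" "(1 + 1) mod 4 = (2::nat)" "(2 + 1) mod 4 = (3::nat)"
      "(3 + 1) mod 4 = (0::nat)" by simp_all
    have "e \<in> boundary_edges T \<longleftrightarrow> (\<exists>i<4. e = {w i, w ((i + 1) mod 4)})" for e
      using w(1) by (auto simp: boundary_cycle_def)
    then have *: "e \<in> boundary_edges T \<longleftrightarrow>
        e = {w 0, w 1} \<or> e = {w 1, w 2} \<or> e = {w 2, w 3} \<or> e = {w 3, w 0}" for e
      unfolding ex4 mods .
    show ?thesis by (intro set_eqI) (simp only: * insert_iff empty_iff simp_thms)
  qed
  have "inj_on w {..<4}" using w(1) by (simp add: boundary_cycle_def)
  then have dist: "distinct [w 0, w 1, w 2, w 3]" by (simp add: inj_on_eq_iff)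
  have cliques: "\<forall>t\<in>T. card t = 3 \<and> clique t"
  proof (intro ballI conjI)
    fix t assume "t \<in> T"
    then show "card t = 3" using T by (simp add: triangulated_surface_def)
    show "clique t" unfolding clique_def
    proof (intro ballI)
      fix x y assume "x \<in> t" "y \<in> t"
      then show "(dist (f x) (f y))\<^sup>2 \<in> R"
        using unit \<open>t \<in> T\<close> closed(1,2) by (cases "x = y") auto
    qed
  qed
  \<comment> \<open>Edges of the surface have degree 1 or 2 and all other pairs have degree 0, so
    odd degree singles out the boundary edges.\<close>
  have boundary: "odd (edge_deg T e) \<longleftrightarrow> e \<in> {{w 0, w 1}, {w 1, w 2}, {w 2, w 3}, {w 3, w 0}}"
    if "card e = 2" for e
  proof (cases "e \<in> cplx_edges T")
    case True
    then have "edge_deg T e = 1 \<or> edge_deg T e = 2" using T by (simp add: triangulated_surface_def)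
    then show ?thesis using True unfolding B[symmetric] by (auto simp: boundary_edges_def)
  next
    case False
    then have "{t \<in> T. e \<subseteq> t} = {}" using that by (auto simp: cplx_edges_def)
    then have "even (edge_deg T e)" by (simp only: edge_deg_def card.empty) simp
    then show ?thesis using False unfolding B[symmetric] by (auto simp: boundary_edges_def)
  qed
  have "finite T" using T by (simp add: triangulated_surface_def)
  then have "(dist (f (w 0)) (f (w 2)))\<^sup>2 \<in> R \<or> (dist (f (w 1)) (f (w 3)))\<^sup>2 \<in> R"
    using cliques dist boundary by (rule bounding_four_cycle_has_diagonal[OF _ _ _ allI[OF impI]])
  then show False using w(2) R(4,5) assms(3) by (simp add: unit_rhombus_def)
qed

end
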